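(* Let $(X,d)$ be a metric space and let $\succcurlyeq$ be a radial partial order on $(X,d)$. Then $\succcurlyeq$, viewed as the set $\{(x,y)\in X\times X: x\succcurlyeq y\}$, is a closed subset of $X\times X$ (with the product topology).
   Context: For a partial order $\succcurlyeq$ on a nonempty metric space $(X,d)$, write $x\succ y$ if $x\succcurlyeq y$ and $x\neq y$, and write $x\succcurlyeq^{\bullet}y$ if it is not the case that $y\succcurlyeq x$. The partial order $\succcurlyeq$ is radial if for all $x,y,z\in X$: (i) $x\succcurlyeq^{\bullet}y\succ z$ implies $d(x,z)\ge d(x,y)$; and (ii) $x\succ y\succcurlyeq^{\bullet}z$ implies $d(x,z)\ge d(y,z)$. *)

theory Defs
  imports "HOL-Analysis.Analysis"
begin

(* Orientation: for a partial order r, the pair (x, y) \<in> r is read as "x \<succcurlyeq> y"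
   (Order_Relation usually reads such a pair as x \<le> y). *)

definition strictly_above :: "('a \<times> 'a) set \<Rightarrow> 'a \<Rightarrow> 'a \<Rightarrow> bool" where
  "strictly_above r x y \<longleftrightarrow> (x, y) \<in> r \<and> x \<noteq> y"

(* Written x \<succcurlyeq>\<^bold>\<bullet> y in the literature: y is not above x. For a partial order this means
   that x is strictly above y or that x and y are incomparable. *)
definition not_below :: "('a \<times> 'a) set \<Rightarrow> 'a \<Rightarrow> 'a \<Rightarrow> bool" where
  "not_below r x y \<longleftrightarrow> (y, x) \<notin> r"

definition radial_on :: "'a set \<Rightarrow> ('a \<Rightarrow> 'a \<Rightarrow> real) \<Rightarrow> ('a \<times> 'a) set \<Rightarrow> bool" where
  "radial_on X d r \<longleftrightarrow>
     (\<forall>x\<in>X. \<forall>y\<in>X. \<forall>z\<in>X.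
        (not_below r x y \<and> strictly_above r y z \<longrightarrow> d x z \<ge> d x y) \<and>
        (strictly_above r x y \<and> not_below r y z \<longrightarrow> d x z \<ge> d y z))"

end

theory Submission
  imports Defs
begin

text \<open>
  The complement of the order is open, with an explicit radius: if \<open>x \<succcurlyeq> y\<close> fails, then no point
  \<open>x'\<close> closer to \<open>x\<close> than \<open>d x y / 2\<close> lies above a point \<open>y'\<close> that close to \<open>y\<close>. Suppose
  \<open>x' \<succcurlyeq> y'\<close>. The triangle inequality keeps \<open>y'\<close> away from \<open>x\<close> and \<open>x'\<close>. If \<open>x\<close> is above \<open>y'\<close>,
  then \<open>y \<succcurlyeq>\<^bold>\<bullet> x \<succ> y'\<close>, and the first half of radiality makes \<open>y'\<close> at least as far from \<open>y\<close> as
  \<open>x\<close> is. Otherwise \<open>x' \<succ> y' \<succcurlyeq>\<^bold>\<bullet> x\<close>, and the second half makes \<open>x'\<close> at least as far from \<open>x\<close>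
  as \<open>y'\<close> is. Either way a point lies outside its ball.
\<close>

lemma (in Metric_space) radial_not_related_near:
  assumes "radial_on M d r" and "x \<in> M" "y \<in> M" and "(x, y) \<notin> r"
    and x': "x' \<in> mball x (d x y / 2)" and y': "y' \<in> mball y (d x y / 2)"
  shows "(x', y') \<notin> r"
proof
  assume "(x', y') \<in> r"
  have M: "x' \<in> M" "y' \<in> M" and dx: "d x x' < d x y / 2" and dy: "d y y' < d x y / 2"
    using x' y' by auto
  have far: "d x y' > d x y / 2"
    using triangle[of x y' y] assms M dy commute[of y' y] by auto
  have "x \<noteq> y'"
    using far \<open>x \<in> M\<close> zero[of x x] nonneg[of x y] by fastforce
  have "x' \<noteq> y'"
    using far dx by auto
  show False
  proof (cases "(x, y') \<in> r")
    case True
    then have "d y y' \<ge> d y x"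
      using assms M \<open>x \<noteq> y'\<close> unfolding radial_on_def strictly_above_def not_below_def by blast
    then show False
      using dy commute[of x y] nonneg[of x y] by linarith
  next
    case False
    then have "d x' x \<ge> d y' x"
      using assms M \<open>(x', y') \<in> r\<close> \<open>x' \<noteq> y'\<close>
      unfolding radial_on_def strictly_above_def not_below_def by blast
    then show False
      using far dx commute[of x x'] commute[of x y'] by linarith
  qed
qed

theorem corollary6:
  fixes X :: "'a set" and d :: "'a \<Rightarrow> 'a \<Rightarrow> real" and r :: "('a \<times> 'a) set"
  assumes "Metric_space X d"
    and "X \<noteq> {}"
    and "partial_order_on X r"
    and "radial_on X d r"
  shows "closedin (prod_topology (Metric_space.mtopology X d) (Metric_space.mtopology X d))
           {(x, y) \<in> X \<times> X. (x, y) \<in> r}"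
proof -
  interpret Metric_space X d by fact
  have "\<exists>U V. openin mtopology U \<and> openin mtopology V \<and> x \<in> U \<and> y \<in> V
          \<and> U \<times> V \<subseteq> X \<times> X - {(x, y) \<in> X \<times> X. (x, y) \<in> r}"
    if "x \<in> X" "y \<in> X" "(x, y) \<notin> r" for x y
  proof (intro exI conjI)
    \<comment> \<open>Reflexivity makes the radius of the two balls positive.\<close>
    have "x \<noteq> y"
      using that \<open>partial_order_on X r\<close>
      by (auto simp: partial_order_on_def preorder_on_def refl_on_def)
    then have "d x y > 0"
      using that by simp
    then show "x \<in> mball x (d x y / 2)" "y \<in> mball y (d x y / 2)"
      using that by simp_all
    show "mball x (d x y / 2) \<times> mball y (d x y / 2)
            \<subseteq> X \<times> X - {(x, y) \<in> X \<times> X. (x, y) \<in> r}"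
      using radial_not_related_near[OF \<open>radial_on X d r\<close> that] mball_subset_mspace by blast
  qed (rule openin_mball)+
  then have "openin (prod_topology mtopology mtopology)
               (X \<times> X - {(x, y) \<in> X \<times> X. (x, y) \<in> r})"
    by (auto simp: openin_prod_topology_alt)
  then show ?thesis
    by (auto simp: closedin_def)
qed

end
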